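(* For $n\ge 1$ let $E_{2,=}(n)$ be the number of equivalence relations on $[n]=\{1,\ldots,n\}$ with exactly two equivalence classes, both of the same size. Then $E_{2,=}(2n)=\frac12\binom{2n}{n}$ for all $n\ge 1$, and $E_{2,=}(2n+1)=0$ for all $n\ge 0$. The function $E_{2,=}$ is a counting order invariant $\mathrm{MSOL}^2$-Specker function. However, $E_{2,=}$ is not ultimately periodic modulo $2$, and hence does not satisfy a linear recurrence relation with constant coefficients over $\mathbb{Z}_2$.
   Context: $\mathbb{N}=\{0,1,2,\ldots\}$ and $[n]=\{1,\ldots,n\}$. Structures have nonempty universes, so all counting functions are considered for arguments $n\ge 1$. A function $f:\{1,2,\ldots\}\to\mathbb{N}$ is ultimately periodic modulo $m$ if there are $i\ge 1$ and $n_0$ such that $f(n+i)\equiv f(n)\pmod m$ for all $n\ge n_0$. It satisfies a linear recurrence relation with constant coefficients over $\mathbb{Z}_m$ if there are $d\ge 1$ and constants $a_1,\ldots,a_d$ with $f(n)\equiv\sum_{j=1}^d a_j f(n-j)\pmod m$ for all $n>d$. $\mathrm{MSOL}$ is Monadic Second Order Logic (first order logic with equality extended by quantification over subsets of the universe). Let $\bar R=(R_1,\ldots,R_s)$ be a finite tuple of relation symbols, $R_i$ of arity $\rho(i)$. A class $\mathcal{D}$ of ordered $\bar R$-structures is a class of finite $\bar R\cup\{<_1\}$-structures in which the binary symbol $<_1$ is always interpreted as a linear order of the universe. It is definable in $\mathrm{MSOL}$ if there is an $\mathrm{MSOL}$-sentence $\phi$ over the vocabulary $\bar R\cup\{<_1\}$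 such that an ordered $\bar R$-structure is in $\mathcal{D}$ iff it satisfies $\phi$. For a linear order $<_1$ of $[n]$ let $$osp_{\mathcal{D}}(n,<_1)=\big|\{(R_1,\ldots,R_s): R_i\subseteq[n]^{\rho(i)},\ \langle[n],<_1,R_1,\ldots,R_s\rangle\in\mathcal{D}\}\big|.$$ A function $f:\{1,2,\ldots\}\to\mathbb{N}$ is a counting order invariant $\mathrm{MSOL}^k$-Specker function if there are a finite set of relation symbols $\bar R$ of arity at most $k$ and a class $\mathcal{D}$ of ordered $\bar R$-structures definable in $\mathrm{MSOL}$ such that for all $n\ge 1$ and all linear orders $<_1,<_2$ of $[n]$ we have $f(n)=osp_{\mathcal{D}}(n,<_1)=osp_{\mathcal{D}}(n,<_2)$. *)

theory Defs
  imports Complex_Main "HOL-Number_Theory.Cong"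
begin

section \<open>Eventual periodicity and linear recurrences modulo \<open>m\<close>\<close>

text \<open>
  Counting functions have domain \<open>{1, 2, \<dots>}\<close>. They are represented by functions on
  \<^typ>\<open>nat\<close> whose value at \<open>0\<close> is never consulted by the definitions below.
\<close>

definition ultimately_periodic_mod :: "nat \<Rightarrow> (nat \<Rightarrow> nat) \<Rightarrow> bool" where
  "ultimately_periodic_mod m f \<longleftrightarrow>
     (\<exists>i\<ge>1. \<exists>n0\<ge>1. \<forall>n\<ge>n0. [f (n + i) = f n] (mod m))"

text \<open>The coefficients in \<open>\<int>\<^sub>m\<close> are given by integer representatives.\<close>

definition satisfies_linear_recurrence_mod :: "nat \<Rightarrow> (nat \<Rightarrow> nat) \<Rightarrow> bool" where
  "satisfies_linear_recurrence_mod m f \<longleftrightarrow>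
     (\<exists>d\<ge>1. \<exists>a :: nat \<Rightarrow> int. \<forall>n>d.
        [int (f n) = (\<Sum>j = 1..d. a j * int (f (n - j)))] (mod int m))"


section \<open>Ordered structures\<close>

text \<open>
  A finite tuple of relation symbols is given by the list \<open>\<rho>\<close> of their arities. A relation of
  arity \<open>k\<close> is a set of lists of length \<open>k\<close>.
\<close>

definition tuples :: "'a set \<Rightarrow> nat \<Rightarrow> 'a list set" where
  "tuples A k = {xs. set xs \<subseteq> A \<and> length xs = k}"

definition relation_tuples :: "nat list \<Rightarrow> 'a set \<Rightarrow> 'a list set list set" where
  "relation_tuples \<rho> A =
     {Rs. length Rs = length \<rho> \<and> (\<forall>i < length \<rho>. Rs ! i \<subseteq> tuples A (\<rho> ! i))}"

text \<open>
  Being the interpretation of \<open><\<close>, a linear order is taken to be strict.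
  The inclusion is not part of \<^const>\<open>strict_linear_order_on\<close>.
\<close>

definition is_linear_order :: "'a set \<Rightarrow> ('a \<times> 'a) set \<Rightarrow> bool" where
  "is_linear_order A r \<longleftrightarrow> r \<subseteq> A \<times> A \<and> strict_linear_order_on A r"

record 'a ostruct =
  universe :: "'a set"
  ord_rel :: "('a \<times> 'a) set"
  rels :: "'a list set list"

definition ordered_structure :: "nat list \<Rightarrow> 'a ostruct \<Rightarrow> bool" where
  "ordered_structure \<rho> \<AA> \<longleftrightarrow>
     finite (universe \<AA>) \<and> universe \<AA> \<noteq> {} \<and>
     is_linear_order (universe \<AA>) (ord_rel \<AA>) \<and>
     rels \<AA> \<in> relation_tuples \<rho> (universe \<AA>)"


section \<open>Monadic second order logic\<close>

text \<open>
  First order and set variables are both named by natural numbers, in separate name spaces.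
  \<open>Rel i xs\<close> applies the \<open>i\<close>-th relation symbol (counted from \<open>0\<close>) to the variables \<open>xs\<close>.
  The other connectives and the universal quantifiers are definable.
\<close>

datatype mso =
    Eq nat nat
  | Less nat nat
  | Rel nat "nat list"
  | Mem nat nat
  | Neg mso
  | Conj mso mso
  | Ex nat mso
  | ExSet nat mso

primrec wf_mso :: "nat list \<Rightarrow> mso \<Rightarrow> bool" where
  "wf_mso \<rho> (Eq x y) \<longleftrightarrow> True"
| "wf_mso \<rho> (Less x y) \<longleftrightarrow> True"
| "wf_mso \<rho> (Rel i xs) \<longleftrightarrow> i < length \<rho> \<and> length xs = \<rho> ! i"
| "wf_mso \<rho> (Mem x X) \<longleftrightarrow> True"
| "wf_mso \<rho> (Neg \<phi>) \<longleftrightarrow> wf_mso \<rho> \<phi>"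
| "wf_mso \<rho> (Conj \<phi> \<psi>) \<longleftrightarrow> wf_mso \<rho> \<phi> \<and> wf_mso \<rho> \<psi>"
| "wf_mso \<rho> (Ex x \<phi>) \<longleftrightarrow> wf_mso \<rho> \<phi>"
| "wf_mso \<rho> (ExSet X \<phi>) \<longleftrightarrow> wf_mso \<rho> \<phi>"

primrec free_vars :: "mso \<Rightarrow> nat set" where
  "free_vars (Eq x y) = {x, y}"
| "free_vars (Less x y) = {x, y}"
| "free_vars (Rel i xs) = set xs"
| "free_vars (Mem x X) = {x}"
| "free_vars (Neg \<phi>) = free_vars \<phi>"
| "free_vars (Conj \<phi> \<psi>) = free_vars \<phi> \<union> free_vars \<psi>"
| "free_vars (Ex x \<phi>) = free_vars \<phi> - {x}"
| "free_vars (ExSet X \<phi>) = free_vars \<phi>"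

primrec free_set_vars :: "mso \<Rightarrow> nat set" where
  "free_set_vars (Eq x y) = {}"
| "free_set_vars (Less x y) = {}"
| "free_set_vars (Rel i xs) = {}"
| "free_set_vars (Mem x X) = {X}"
| "free_set_vars (Neg \<phi>) = free_set_vars \<phi>"
| "free_set_vars (Conj \<phi> \<psi>) = free_set_vars \<phi> \<union> free_set_vars \<psi>"
| "free_set_vars (Ex x \<phi>) = free_set_vars \<phi>"
| "free_set_vars (ExSet X \<phi>) = free_set_vars \<phi> - {X}"

definition mso_sentence :: "nat list \<Rightarrow> mso \<Rightarrow> bool" where
  "mso_sentence \<rho> \<phi> \<longleftrightarrow> wf_mso \<rho> \<phi> \<and> free_vars \<phi> = {} \<and> free_set_vars \<phi> = {}"

primrec sat :: "'a ostruct \<Rightarrow> (nat \<Rightarrow> 'a) \<Rightarrow> (nat \<Rightarrow> 'a set) \<Rightarrow> mso \<Rightarrow> bool" where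
  "sat \<AA> v V (Eq x y) \<longleftrightarrow> v x = v y"
| "sat \<AA> v V (Less x y) \<longleftrightarrow> (v x, v y) \<in> ord_rel \<AA>"
| "sat \<AA> v V (Rel i xs) \<longleftrightarrow> map v xs \<in> rels \<AA> ! i"
| "sat \<AA> v V (Mem x X) \<longleftrightarrow> v x \<in> V X"
| "sat \<AA> v V (Neg \<phi>) \<longleftrightarrow> \<not> sat \<AA> v V \<phi>"
| "sat \<AA> v V (Conj \<phi> \<psi>) \<longleftrightarrow> sat \<AA> v V \<phi> \<and> sat \<AA> v V \<psi>"
| "sat \<AA> v V (Ex x \<phi>) \<longleftrightarrow> (\<exists>a \<in> universe \<AA>. sat \<AA> (v(x := a)) V \<phi>)"
| "sat \<AA> v V (ExSet X \<phi>) \<longleftrightarrow> (\<exists>B \<subseteq> universe \<AA>. sat \<AA> v (V(X := B)) \<phi>)"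

text \<open>Truth of a sentence does not depend on the assignments.\<close>

lemma sat_cong:
  assumes "\<And>x. x \<in> free_vars \<phi> \<Longrightarrow> v x = w x"
    and "\<And>X. X \<in> free_set_vars \<phi> \<Longrightarrow> V X = W X"
  shows "sat \<AA> v V \<phi> \<longleftrightarrow> sat \<AA> w W \<phi>"
  using assms
proof (induction \<phi> arbitrary: v w V W)
  case (Rel i xs)
  then have "map v xs = map w xs" by simp
  then show ?case by (simp only: sat.simps)
next
  case (Neg \<phi>)
  have "sat \<AA> v V \<phi> \<longleftrightarrow> sat \<AA> w W \<phi>" using Neg.prems by (intro Neg.IH) auto
  then show ?case by simp
next
  case (Conj \<phi> \<psi>)
  have "sat \<AA> v V \<phi> \<longleftrightarrow> sat \<AA> w W \<phi>" using Conj.prems by (intro Conj.IH(1)) auto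
  moreover have "sat \<AA> v V \<psi> \<longleftrightarrow> sat \<AA> w W \<psi>" using Conj.prems by (intro Conj.IH(2)) auto
  ultimately show ?case by simp
next
  case (Ex x \<phi>)
  have "sat \<AA> (v(x := a)) V \<phi> \<longleftrightarrow> sat \<AA> (w(x := a)) W \<phi>" for a
    using Ex.prems by (intro Ex.IH) auto
  then show ?case by simp
next
  case (ExSet X \<phi>)
  have "sat \<AA> v (V(X := B)) \<phi> \<longleftrightarrow> sat \<AA> w (W(X := B)) \<phi>" for B
    using ExSet.prems by (intro ExSet.IH) auto
  then show ?case by simp
qed simp_all

definition models :: "'a ostruct \<Rightarrow> mso \<Rightarrow> bool" where
  "models \<AA> \<phi> \<longleftrightarrow> (\<forall>v V. sat \<AA> v V \<phi>)"

lemma models_iff_sat: "mso_sentence \<rho> \<phi> \<Longrightarrow> models \<AA> \<phi> \<longleftrightarrow> sat \<AA> v V \<phi>"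
  using sat_cong[of \<phi> _ v _ V \<AA>] by (auto simp: models_def mso_sentence_def)


section \<open>Order invariant Specker functions\<close>

text \<open>
  Every finite structure is isomorphic to one whose universe consists of natural numbers, so
  classes of structures are sets of structures over \<^typ>\<open>nat\<close>.
\<close>

definition ordered_class :: "nat list \<Rightarrow> nat ostruct set \<Rightarrow> bool" where
  "ordered_class \<rho> D \<longleftrightarrow> (\<forall>\<AA> \<in> D. ordered_structure \<rho> \<AA>)"

definition mso_definable :: "nat list \<Rightarrow> nat ostruct set \<Rightarrow> bool" where
  "mso_definable \<rho> D \<longleftrightarrow>
     (\<exists>\<phi>. mso_sentence \<rho> \<phi> \<and> (\<forall>\<AA>. ordered_structure \<rho> \<AA> \<longrightarrow> (\<AA> \<in> D \<longleftrightarrow> models \<AA> \<phi>)))"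

definition osp :: "nat list \<Rightarrow> nat ostruct set \<Rightarrow> nat \<Rightarrow> (nat \<times> nat) set \<Rightarrow> nat" where
  "osp \<rho> D n r =
     card {Rs \<in> relation_tuples \<rho> {1..n}.
             \<lparr>universe = {1..n}, ord_rel = r, rels = Rs\<rparr> \<in> D}"

lemma finite_relation_tuples:
  assumes "finite A"
  shows "finite (relation_tuples \<rho> A)"
proof (rule finite_subset)
  let ?T = "\<Union>k \<in> set \<rho>. Pow (tuples A k)"
  show "relation_tuples \<rho> A \<subseteq> {Rs. set Rs \<subseteq> ?T \<and> length Rs = length \<rho>}"
  proof
    fix Rs assume Rs: "Rs \<in> relation_tuples \<rho> A"
    have "R \<in> ?T" if R: "R \<in> set Rs" for R
    proof -
      obtain i where "i < length Rs" "R = Rs ! i" using R by (auto simp: in_set_conv_nth)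
      then show ?thesis using Rs unfolding relation_tuples_def by force
    qed
    then show "Rs \<in> {Rs. set Rs \<subseteq> ?T \<and> length Rs = length \<rho>}"
      using Rs by (auto simp: relation_tuples_def)
  qed
  have "finite (tuples A k)" for k
    unfolding tuples_def using assms by (rule finite_lists_length_eq)
  then show "finite {Rs. set Rs \<subseteq> ?T \<and> length Rs = length \<rho>}"
    by (intro finite_lists_length_eq) auto
qed

definition order_invariant_specker :: "nat \<Rightarrow> (nat \<Rightarrow> nat) \<Rightarrow> bool" where
  "order_invariant_specker k f \<longleftrightarrow>
     (\<exists>\<rho> D. (\<forall>a \<in> set \<rho>. a \<le> k) \<and> ordered_class \<rho> D \<and> mso_definable \<rho> D \<and>
        (\<forall>n\<ge>1. \<forall>r1 r2. is_linear_order {1..n} r1 \<and> is_linear_order {1..n} r2 \<longrightarrow>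
           f n = osp \<rho> D n r1 \<and> osp \<rho> D n r1 = osp \<rho> D n r2))"


section \<open>Equivalence relations with two classes of equal size\<close>

definition E2eq :: "nat \<Rightarrow> nat" where
  "E2eq n =
     card {r. equiv {1..n} r \<and> card ({1..n} // r) = 2 \<and>
              (\<forall>X \<in> {1..n} // r. \<forall>Y \<in> {1..n} // r. card X = card Y)}"

end

theory Submission
  imports Defs
begin

text \<open>
  Equal cardinality of two classes is not expressible in monadic second order logic, but it can
  be witnessed: instead of the equivalence relation, the counted structures carry a binary relation
  that is an order preserving bijection from the class of the least element onto its complement.
  Such a bijection exists iff the two classes have the same size, and it is then unique, whatever
  the order is. Modulo \<open>2\<close>, Lucas' congruences show that \<open>E\<^sub>2\<^sub>,\<^sub>=(4n) \<equiv> E\<^sub>2\<^sub>,\<^sub>=(2n)\<close>, so the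
  function is odd at the powers of \<open>2\<close> and even at \<open>2\<^sup>kq\<close> for odd \<open>q > 1\<close> and at odd numbers. A period
  \<open>i\<close> would lead from a power \<open>N\<close> of \<open>2\<close> to the even values at \<open>N(1 + i)\<close> or \<open>N + i\<close>.
\<close>

section \<open>Linear recurrences and periodicity\<close>

text \<open>By pigeonhole two windows of \<open>d\<close> consecutive residues coincide, and the
  recurrence propagates this agreement to all later values.\<close>

lemma linear_recurrence_imp_ultimately_periodic:
  assumes "m > 0" and "satisfies_linear_recurrence_mod m f"
  shows "ultimately_periodic_mod m f"
proof -
  obtain d a where rec: "\<And>n. n > d \<Longrightarrow>
      [int (f n) = (\<Sum>j = 1..d. a j * int (f (n - j)))] (mod int m)"
    using assms(2) unfolding satisfies_linear_recurrence_mod_def by blast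
  define state where "state n = map (\<lambda>j. f (n + j) mod m) [0..<d]" for n
  have "state ` {1..} \<subseteq> {xs. set xs \<subseteq> {..<m} \<and> length xs = d}"
    using \<open>m > 0\<close> by (auto simp: state_def)
  then have "finite (state ` {1..})"
    by (rule finite_subset) (simp add: finite_lists_length_eq)
  then have "\<not> inj_on state {1..}"
    using finite_imageD infinite_Ici by blast
  \<comment> \<open>Since the windows start at \<open>p, q \<ge> 1\<close>, the indices
    \<open>p + t\<close> and \<open>q + t\<close> exceed \<open>d\<close> as soon as
    \<open>t \<ge> d\<close>, as \<open>rec\<close> demands.\<close>
  then obtain p q where "p \<ge> 1" "p < q" and pq: "state p = state q"
    unfolding inj_on_def by (metis atLeast_iff linorder_neqE_nat)
  have step: "[f (q + t) = f (p + t)] (mod m)" for t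
  proof (induction t rule: less_induct)
    case (less t)
    show ?case
    proof (cases "t < d")
      case True
      then have "state p ! t = state q ! t" using pq by simp
      then show ?thesis using True by (simp add: state_def cong_def)
    next
      case False
      have "[int (f (q + t)) = (\<Sum>j = 1..d. a j * int (f (q + t - j)))] (mod int m)"
        using False \<open>p \<ge> 1\<close> \<open>p < q\<close> by (intro rec) simp
      also have "[(\<Sum>j = 1..d. a j * int (f (q + t - j))) =
          (\<Sum>j = 1..d. a j * int (f (p + t - j)))] (mod int m)"
      proof (intro cong_sum cong_mult cong_refl)
        fix j assume "j \<in> {1..d}"
        then have "[f (q + (t - j)) = f (p + (t - j))] (mod m)"
          using False by (intro less.IH) auto
        then show "[int (f (q + t - j)) = int (f (p + t - j))] (mod int m)"
          using \<open>j \<in> {1..d}\<close> False by (simp add: cong_int_iff)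
      qed
      also have "[(\<Sum>j = 1..d. a j * int (f (p + t - j))) = int (f (p + t))] (mod int m)"
        using False \<open>p \<ge> 1\<close> by (intro cong_sym[OF rec]) simp
      finally show ?thesis by (simp add: cong_int_iff)
    qed
  qed
  have "[f (n + (q - p)) = f n] (mod m)" if "n \<ge> p" for n
    using step[of "n - p"] that \<open>p < q\<close> by (simp add: add.commute)
  then show ?thesis
    unfolding ultimately_periodic_mod_def using \<open>p \<ge> 1\<close> \<open>p < q\<close>
    by (intro exI[of _ "q - p"] conjI exI[of _ p]) auto
qed


section \<open>Equivalence relations with two classes of equal size\<close>

text \<open>Two complementary classes form an unordered pair. Requiring \<open>m\<close> selects one
  of them, so each partition into equal parts is counted once.\<close>

definition halves :: "'a set \<Rightarrow> 'a \<Rightarrow> 'a set set" where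
  "halves U m = {A. A \<subseteq> U \<and> m \<in> A \<and> 2 * card A = card U}"

lemma card_compl_half:
  assumes "finite U" "A \<in> halves U m"
  shows "card (U - A) = card A"
proof -
  have "A \<subseteq> U" "2 * card A = card U" using assms(2) by (auto simp: halves_def)
  then show ?thesis using assms(1) by (simp add: card_Diff_subset finite_subset)
qed

lemma card_equiv_two_equal_classes:
  assumes "finite U" "m \<in> U"
  shows "card {r. equiv U r \<and> card (U // r) = 2 \<and> (\<forall>X \<in> U // r. \<forall>Y \<in> U // r. card X = card Y)}
    = card (halves U m)" (is "card ?E = _")
proof (rule sym, rule bij_betw_same_card)
  let ?h = "\<lambda>A. A \<times> A \<union> (U - A) \<times> (U - A)"
  show "bij_betw ?h (halves U m) ?E"
  proof (rule bij_betw_imageI)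
    show "inj_on ?h (halves U m)"
    proof (rule inj_onI)
      fix A B assume AB: "A \<in> halves U m" "B \<in> halves U m" and eq: "?h A = ?h B"
      \<comment> \<open>The class of \<open>m\<close> under \<open>?h C\<close> is \<open>C\<close>
        again.\<close>
      have "C = ?h C `` {m}" if "C \<in> halves U m" for C
        using that by (auto simp: halves_def)
      then show "A = B" using AB eq by metis
    qed
    show "?h ` halves U m = ?E"
    proof (intro equalityI subsetI)
      fix r assume "r \<in> ?h ` halves U m"
      then obtain A where A: "A \<in> halves U m" and r: "r = ?h A" by auto
      have AU: "A \<subseteq> U" "m \<in> A" using A by (auto simp: halves_def)
      have c: "card (U - A) = card A" using card_compl_half[OF assms(1) A] .
      have "card A > 0" using AU assms(1) finite_subset by (auto simp: card_gt_0_iff)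
      then obtain b where b: "b \<in> U - A" using c by (metis card_gt_0_iff equals0I)
      have "r `` {x} = (if x \<in> A then A else U - A)" if "x \<in> U" for x
        using that AU by (auto simp: r)
      then have "U // r = (\<lambda>x. if x \<in> A then A else U - A) ` U"
        by (auto simp: quotient_def)
      also have "\<dots> = {A, U - A}" using AU b by auto
      finally have q: "U // r = {A, U - A}" .
      have "A \<noteq> U - A" using AU by auto
      then have "card (U // r) = 2" by (simp add: q)
      moreover have "equiv U r"
        using AU by (intro equivI) (auto simp: r refl_on_def sym_def trans_def)
      ultimately show "r \<in> ?E" using c q by auto
    next
      fix r assume "r \<in> ?E"
      then have r: "equiv U r" and "card (U // r) = 2"
        and eq: "\<And>X Y. X \<in> U // r \<Longrightarrow> Y \<in> U // r \<Longrightarrow> card X = card Y" by blast+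
      define A where "A = r `` {m}"
      have A: "A \<in> U // r" using assms(2) by (auto simp: A_def quotientI)
      have "card (U // r - {A}) = 1" using \<open>card (U // r) = 2\<close> A by simp
      then obtain B where "U // r - {A} = {B}" by (elim card_1_singletonE)
      then have B: "U // r = {A, B}" "A \<noteq> B" using A by blast+
      have "A \<inter> B = {}" using quotient_disj[OF r, of A B] B by auto
      moreover have U: "A \<union> B = U" using Union_quotient[OF r] B by simp
      ultimately have BU: "B = U - A" by auto
      have "card U = card A + card B"
        using assms(1) U \<open>A \<inter> B = {}\<close> card_Un_disjoint finite_Un by metis
      then have "2 * card A = card U" using eq[of A B] B by simp
      moreover have "m \<in> A" using equiv_class_self[OF r assms(2)] by (simp add: A_def)
      ultimately have "A \<in> halves U m" using U by (auto simp: halves_def)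
      moreover have "r = ?h A"
      proof -
        \<comment> \<open>An equivalence relation is the union of the squares of its
          classes.\<close>
        have "r = (\<Union>X\<in>U // r. X \<times> X)"
        proof (intro equalityI subsetI; clarify)
          fix x y assume xy: "(x, y) \<in> r"
          then have "x \<in> U" using r by (auto simp: equiv_def)
          then have "r `` {x} \<in> U // r" "x \<in> r `` {x}" "y \<in> r `` {x}"
            using equiv_class_self[OF r] xy by (auto simp: quotientI)
          then show "(x, y) \<in> (\<Union>X\<in>U // r. X \<times> X)" by blast
        next
          fix x y X assume "X \<in> U // r" "x \<in> X" "y \<in> X"
          then show "(x, y) \<in> r" using quotient_eq_iff[OF r, of X X x y] by simp
        qed
        then show ?thesis using B BU by auto
      qed
      ultimately show "r \<in> ?h ` halves U m" by blast
    qed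
  qed
qed

section \<open>Closed form in binomial coefficients\<close>

lemma E2eq_eq_card_halves: "m \<in> {1..n} \<Longrightarrow> E2eq n = card (halves {1..n} m)"
  unfolding E2eq_def by (rule card_equiv_two_equal_classes) auto

text \<open>Removing \<open>m\<close> leaves an arbitrary \<open>k\<close>-subset of the other
  \<open>2 * k + 1\<close> elements.\<close>

lemma card_halves:
  assumes "finite U" "m \<in> U" "card U = 2 * Suc k"
  shows "card (halves U m) = (2 * k + 1) choose k"
proof -
  have "bij_betw (insert m) {B. B \<subseteq> U - {m} \<and> card B = k} (halves U m)"
  proof (rule bij_betw_imageI)
    show "inj_on (insert m) {B. B \<subseteq> U - {m} \<and> card B = k}"
      by (auto simp: inj_on_def)
    show "insert m ` {B. B \<subseteq> U - {m} \<and> card B = k} = halves U m"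
    proof (intro equalityI subsetI)
      fix A assume "A \<in> insert m ` {B. B \<subseteq> U - {m} \<and> card B = k}"
      then obtain B where B: "A = insert m B" "B \<subseteq> U - {m}" "card B = k" by auto
      then have "finite B" "m \<notin> B" using assms(1) finite_subset by auto
      then show "A \<in> halves U m" using B assms by (auto simp: halves_def)
    next
      fix A assume A: "A \<in> halves U m"
      then have "A = insert m (A - {m})" "A - {m} \<subseteq> U - {m}" "card (A - {m}) = k"
        using assms by (auto simp: halves_def)
      then show "A \<in> insert m ` {B. B \<subseteq> U - {m} \<and> card B = k}" by blast
    qed
  qed
  then have "card (halves U m) = card {B. B \<subseteq> U - {m} \<and> card B = k}"
    using bij_betw_same_card by metis
  also have "\<dots> = card (U - {m}) choose k"
    using assms(1) by (intro n_subsets) simp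
  finally show ?thesis using assms by simp
qed

lemma E2eq_even: "E2eq (2 * Suc k) = (2 * k + 1) choose k"
  using E2eq_eq_card_halves[of 1 "2 * Suc k"] card_halves[of "{1..2 * Suc k}" 1 k] by simp

lemma E2eq_odd: "E2eq (2 * n + 1) = 0"
proof -
  have "2 * card A \<noteq> card {1..2 * n + 1}" for A :: "nat set" by simp presburger
  then have "halves {1..2 * n + 1} 1 = {}" unfolding halves_def by blast
  then show ?thesis using E2eq_eq_card_halves[of 1 "2 * n + 1"] by simp
qed

text \<open>Pascal's rule gives the two middle entries of an odd row, which are equal by
  symmetry.\<close>

lemma central_binomial_Suc: "(2 * Suc k) choose Suc k = 2 * ((2 * k + 1) choose k)"
proof -
  have "(2 * k + 1) choose Suc k = (2 * k + 1) choose k"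
    using binomial_symmetric[of k "2 * k + 1"] by simp
  then show ?thesis by simp
qed


section \<open>Parity\<close>

text \<open>Lucas' congruence for an even row. Applying Pascal's rule twice adds two entries of the
  row \<open>2 * m\<close> and a doubled one, as in \<open>(1 + x)^2 = 1 + x^2\<close> modulo
  2.\<close>

lemma parity_binomial_double:
  "even ((2 * m) choose (2 * j)) = even (m choose j) \<and> even ((2 * m) choose (2 * j + 1))"
proof (induction m arbitrary: j)
  case 0
  show ?case by (cases j) auto
next
  case (Suc m)
  \<comment> \<open>For \<open>j = 0\<close> the lowest term would have a negative index; the
    \<open>1\<close> standing in for it is subtracted at the end.\<close>
  have 1: "(2 * Suc m) choose (2 * j + 1) =
      (if j = 0 then 1 else ((2 * m) choose (2 * (j - 1) + 1)))
      + 2 * ((2 * m) choose (2 * j)) + ((2 * m) choose (2 * j + 1)) - (if j = 0 then 1 else 0)"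
    by (cases j) auto
  show ?case
  proof (cases j)
    case 0
    then show ?thesis by simp
  next
    case (Suc i)
    have "(2 * Suc m) choose (2 * j) =
        ((2 * m) choose (2 * i)) + 2 * ((2 * m) choose (2 * i + 1)) + ((2 * m) choose (2 * j))"
      using Suc by simp
    then show ?thesis using 1 Suc.IH[of i] Suc.IH[of j] Suc by simp
  qed
qed

lemma parity_binomial_Suc_double:
  "even ((2 * m + 1) choose (2 * j)) = even (m choose j)"
  "even ((2 * m + 1) choose (2 * j + 1)) = even (m choose j)"
proof -
  show "even ((2 * m + 1) choose (2 * j + 1)) = even (m choose j)"
    using parity_binomial_double[of m j] by simp
  show "even ((2 * m + 1) choose (2 * j)) = even (m choose j)"
    using parity_binomial_double[of m j] parity_binomial_double[of m "j - 1"] by (cases j) auto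
qed

text \<open>Both indices of the binomial coefficient for \<open>4 * n\<close> are odd; dropping
  their last binary digits yields the one for \<open>2 * n\<close>.\<close>

lemma parity_E2eq_double: "n \<ge> 1 \<Longrightarrow> even (E2eq (2 * (2 * n))) = even (E2eq (2 * n))"
proof -
  assume "n \<ge> 1"
  then obtain k where n: "n = Suc k" by (cases n) auto
  have "2 * (2 * n) = 2 * Suc (2 * k + 1)" by (simp add: n)
  then have "E2eq (2 * (2 * n)) = (2 * (2 * k + 1) + 1) choose (2 * k + 1)"
    using E2eq_even by metis
  then have "even (E2eq (2 * (2 * n))) = even ((2 * k + 1) choose k)"
    using parity_binomial_Suc_double(2) by metis
  then show ?thesis using E2eq_even[of k] n by simp
qed

lemma parity_E2eq_power_mult:
  "n \<ge> 1 \<Longrightarrow> even (E2eq (2 ^ Suc k * n)) = even (E2eq (2 * n))"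
proof (induction k)
  case (Suc k)
  then show ?case using parity_E2eq_double[of "2 ^ k * n"] by (simp add: mult.assoc)
qed simp

text \<open>Here the lower index \<open>q - 1\<close> is even and positive, and halving leads to a
  central binomial coefficient, which is even.\<close>

lemma even_E2eq_double_odd:
  assumes "odd q" "q > 1"
  shows "even (E2eq (2 * q))"
proof -
  obtain l where "q = 2 * l + 1" using \<open>odd q\<close> by (elim oddE)
  then obtain k where q: "q = Suc (2 * Suc k)" using \<open>q > 1\<close> by (cases l) auto
  have "even (E2eq (2 * q)) = even ((2 * (2 * Suc k) + 1) choose (2 * Suc k))"
    using E2eq_even[of "2 * Suc k"] q by simp
  also have "\<dots> = even ((2 * Suc k) choose Suc k)"
    by (rule parity_binomial_Suc_double(1))
  finally show ?thesis by (simp add: central_binomial_Suc del: mult_Suc_right)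
qed

lemma odd_E2eq_power_two: "odd (E2eq (2 ^ Suc k))"
  using parity_E2eq_power_mult[of 1 k] E2eq_even[of 0] by simp

lemma not_ultimately_periodic_E2eq: "\<not> ultimately_periodic_mod 2 E2eq"
proof
  assume "ultimately_periodic_mod 2 E2eq"
  then obtain i n0 where "i \<ge> 1"
    and per: "\<And>n. n \<ge> n0 \<Longrightarrow> [E2eq (n + i) = E2eq n] (mod 2)"
    unfolding ultimately_periodic_mod_def by blast
  \<comment> \<open>This power of 2 lies in the periodic range, and the exponent
    \<open>Suc n0\<close> makes it even, so that \<open>N + i\<close> is odd for odd
    \<open>i\<close>.\<close>
  define N :: nat where "N = 2 ^ Suc n0"
  have "n0 \<le> N" using less_exp[of "Suc n0"] by (simp add: N_def)
  have mult: "even (E2eq (N + j * i)) = even (E2eq N)" for j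
  proof (induction j)
    case (Suc j)
    then show ?case using cong_dvd_iff[OF per[of "N + j * i"]] \<open>n0 \<le> N\<close>
      by (simp add: ac_simps)
  qed simp
  have "odd (E2eq N)" unfolding N_def by (rule odd_E2eq_power_two)
  moreover have "even (E2eq N)"
  proof (cases "even i")
    case True
    \<comment> \<open>Taking \<open>N\<close> periods multiplies \<open>N\<close> by
      \<open>1 + i\<close>, which is odd and greater than 1.\<close>
    have "N + N * i = 2 ^ Suc n0 * (1 + i)" by (simp add: N_def algebra_simps)
    then have "even (E2eq (N + N * i)) = even (E2eq (2 * (1 + i)))"
      using parity_E2eq_power_mult[of "1 + i" n0] by simp
    then show ?thesis
      using mult[of N] even_E2eq_double_odd[of "1 + i"] True \<open>i \<ge> 1\<close> by simp
  next
    case False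
    then have "odd (N + i)" by (simp add: N_def)
    then obtain l where "N + i = 2 * l + 1" by (elim oddE)
    then have "E2eq (N + i) = 0" using E2eq_odd[of l] by simp
    then show ?thesis using mult[of 1] by simp
  qed
  ultimately show False by simp
qed


section \<open>Monotone matchings\<close>

definition rank :: "('a \<times> 'a) set \<Rightarrow> 'a set \<Rightarrow> 'a \<Rightarrow> nat" where
  "rank r A x = card {y \<in> A. (y, x) \<in> r}"

lemma is_linear_orderD:
  assumes "is_linear_order U r"
  shows "(x, x) \<notin> r"
    and "(x, y) \<in> r \<Longrightarrow> (y, z) \<in> r \<Longrightarrow> (x, z) \<in> r"
    and "x \<in> U \<Longrightarrow> y \<in> U \<Longrightarrow> x \<noteq> y \<Longrightarrow> (x, y) \<in> r \<or> (y, x) \<in> r"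
  using assms unfolding is_linear_order_def strict_linear_order_on_def total_on_def
  by (auto simp: irrefl_def dest: transD)

lemma rank_strict_mono:
  assumes "is_linear_order U r" "finite A" "x \<in> A" "(x, y) \<in> r"
  shows "rank r A x < rank r A y"
  unfolding rank_def
proof (rule psubset_card_mono)
  have "{z \<in> A. (z, x) \<in> r} \<subseteq> {z \<in> A. (z, y) \<in> r}"
    using is_linear_orderD(2)[OF assms(1)] assms(4) by blast
  moreover have "x \<in> {z \<in> A. (z, y) \<in> r} - {z \<in> A. (z, x) \<in> r}"
    using is_linear_orderD(1)[OF assms(1)] assms(3,4) by blast
  ultimately show "{z \<in> A. (z, x) \<in> r} \<subset> {z \<in> A. (z, y) \<in> r}" by blast
qed (simp add: assms(2))

lemma rank_less_iff:
  assumes "is_linear_order U r" "finite A" "A \<subseteq> U" "x \<in> A" "y \<in> A"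
  shows "rank r A x < rank r A y \<longleftrightarrow> (x, y) \<in> r"
  using rank_strict_mono[OF assms(1,2)] is_linear_orderD(3)[OF assms(1), of x y] assms
  by (metis less_asym subsetD)

text \<open>Totality makes ranks injective and irreflexivity keeps them below \<open>card A\<close>,
  so they fill this initial segment.\<close>

lemma bij_betw_rank:
  assumes "is_linear_order U r" "finite A" "A \<subseteq> U"
  shows "bij_betw (rank r A) A {..<card A}"
proof -
  have "inj_on (rank r A) A"
  proof (rule inj_onI)
    fix x y assume xy: "x \<in> A" "y \<in> A" "rank r A x = rank r A y"
    then have "(x, y) \<notin> r" "(y, x) \<notin> r"
      using rank_less_iff[OF assms, of x y] rank_less_iff[OF assms, of y x] by simp_all
    then show "x = y" using is_linear_orderD(3)[OF assms(1)] xy assms(3) by blast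
  qed
  moreover have "rank r A ` A \<subseteq> {..<card A}"
  proof
    fix k assume "k \<in> rank r A ` A"
    then obtain x where x: "x \<in> A" "k = rank r A x" by auto
    have "{y \<in> A. (y, x) \<in> r} \<subset> A" using x is_linear_orderD(1)[OF assms(1)] by blast
    then show "k \<in> {..<card A}" using psubset_card_mono[OF assms(2)] x by (simp add: rank_def)
  qed
  ultimately have "rank r A ` A = {..<card A}"
    by (intro card_subset_eq) (auto simp: card_image)
  then show ?thesis using \<open>inj_on (rank r A) A\<close> by (simp add: bij_betw_def)
qed

text \<open>For a linear order \<open>r\<close> these are the graphs of order isomorphisms from a
  set containing \<open>m\<close> onto its complement, in a form that a sentence with one binary
  symbol can express.\<close>

definition monotone_matchings :: "'a set \<Rightarrow> ('a \<times> 'a) set \<Rightarrow> 'a \<Rightarrow> ('a \<times> 'a) set set" where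
  "monotone_matchings U r m = {R. R \<subseteq> U \<times> U
     \<and> (\<forall>x y x' y'. (x, y) \<in> R \<longrightarrow> (x', y') \<in> R \<longrightarrow> ((x, x') \<in> r \<longleftrightarrow> (y, y') \<in> r))
     \<and> Domain R \<union> Range R = U \<and> Domain R \<inter> Range R = {} \<and> m \<in> Domain R}"

text \<open>A monotone matching pairs elements of equal rank, so its domain determines it;
  conversely, the ranks in a half and in its complement fill the same initial segment.\<close>

lemma card_monotone_matchings:
  assumes lin: "is_linear_order U r" and fin: "finite U"
  shows "card (monotone_matchings U r m) = card (halves U m)"
proof (rule bij_betw_same_card)
  \<comment> \<open>The inverse of \<open>Domain\<close>: pair the elements of equal rank.\<close>
  define M where "M A = {(x, y). x \<in> A \<and> y \<in> U - A \<and> rank r A x = rank r (U - A) y}" for A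
  have unique: "Domain R \<in> halves U m \<and> R = M (Domain R)" if R: "R \<in> monotone_matchings U r m" for R
  proof -
    let ?A = "Domain R" and ?B = "Range R"
    have RU: "R \<subseteq> U \<times> U" and cov: "?A \<union> ?B = U" and disj: "?A \<inter> ?B = {}" and "m \<in> ?A"
      and mono: "\<And>x y x' y'. (x, y) \<in> R \<Longrightarrow> (x', y') \<in> R \<Longrightarrow> (x, x') \<in> r \<longleftrightarrow> (y, y') \<in> r"
      using R unfolding monotone_matchings_def by auto
    \<comment> \<open>Distinct elements are comparable, and \<open>mono\<close> transfers
      comparability between the two sides, where irreflexivity excludes equality.\<close>
    have fst_eq_iff: "x = x' \<longleftrightarrow> y = y'" if "(x, y) \<in> R" "(x', y') \<in> R" for x y x' y'
      using mono[OF that] mono[OF that(2,1)] is_linear_orderD(1)[OF lin]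
        is_linear_orderD(3)[OF lin, of x x'] is_linear_orderD(3)[OF lin, of y y'] that RU
      by blast
    have inj: "inj_on fst R" "inj_on snd R" using fst_eq_iff by (auto simp: inj_on_def)
    then have cards: "card ?A = card ?B" by (metis Domain_fst Range_snd card_image)
    have B: "?B = U - ?A" using cov disj by blast
    have "finite ?A" "finite ?B" using cov fin by (metis finite_Un)+
    then have "card U = card ?A + card ?B" using card_Un_disjoint[OF _ _ disj] cov by simp
    then have half: "?A \<in> halves U m" using cards cov \<open>m \<in> ?A\<close> by (auto simp: halves_def)
    have "R \<subseteq> M ?A"
    proof clarify
      fix x y assume xy: "(x, y) \<in> R"
      \<comment> \<open>Both ranks count the pairs of \<open>R\<close> below \<open>(x, y)\<close>,
        read off through the injective projections.\<close>
      let ?S = "{p \<in> R. (fst p, x) \<in> r}"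
      have S: "?S = {p \<in> R. (snd p, y) \<in> r}" using mono xy by auto
      have "{x' \<in> ?A. (x', x) \<in> r} = fst ` ?S" by force
      then have "rank r ?A x = card ?S"
        using inj(1) by (simp add: rank_def card_image inj_on_subset)
      moreover have "{y' \<in> ?B. (y', y) \<in> r} = snd ` ?S" unfolding S by force
      then have "rank r ?B y = card ?S"
        using inj(2) by (simp add: rank_def card_image inj_on_subset)
      ultimately have "rank r ?A x = rank r ?B y" by simp
      then show "(x, y) \<in> M ?A" using xy B by (auto simp: M_def)
    qed
    \<comment> \<open>The partner \<open>z\<close> of \<open>x\<close> in \<open>R\<close> has the
      same rank as \<open>y\<close>, and ranks are injective on the complement.\<close>
    moreover have "M ?A \<subseteq> R"
    proof clarify
      fix x y assume xy: "(x, y) \<in> M ?A"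
      then obtain z where z: "(x, z) \<in> R" by (auto simp: M_def)
      then have "(x, z) \<in> M ?A" using \<open>R \<subseteq> M ?A\<close> by blast
      then have "rank r (U - ?A) y = rank r (U - ?A) z" "y \<in> U - ?A" "z \<in> U - ?A"
        using xy by (auto simp: M_def)
      moreover have "inj_on (rank r (U - ?A)) (U - ?A)"
        using bij_betw_rank[OF lin, of "U - ?A"] fin by (simp add: bij_betw_def)
      ultimately have "y = z" by (simp add: inj_on_eq_iff)
      then show "(x, y) \<in> R" using z by simp
    qed
    ultimately show ?thesis using half by blast
  qed
  have exist: "M A \<in> monotone_matchings U r m \<and> Domain (M A) = A" if A: "A \<in> halves U m" for A
  proof -
    have AU: "A \<subseteq> U" "m \<in> A" using A by (auto simp: halves_def)
    have fA: "finite A" using AU fin finite_subset by auto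
    have c: "card (U - A) = card A" using card_compl_half[OF fin A] .
    have rA: "rank r A ` A = {..<card A}"
      using bij_betw_rank[OF lin fA] AU by (simp add: bij_betw_def)
    have rB: "rank r (U - A) ` (U - A) = {..<card A}"
      using bij_betw_rank[OF lin, of "U - A"] fin c by (simp add: bij_betw_def)
    have D: "Domain (M A) = A"
    proof (intro equalityI subsetI)
      fix x assume "x \<in> A"
      then have "rank r A x \<in> rank r (U - A) ` (U - A)" using rA rB by blast
      then show "x \<in> Domain (M A)" using \<open>x \<in> A\<close> by (auto simp: M_def)
    qed (auto simp: M_def)
    have Rg: "Range (M A) = U - A"
    proof (intro equalityI subsetI)
      fix y assume "y \<in> U - A"
      then have "rank r (U - A) y \<in> rank r A ` A" using rA rB by blast
      then obtain x where "x \<in> A" "rank r (U - A) y = rank r A x" by blast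
      then have "(x, y) \<in> M A" using \<open>y \<in> U - A\<close> by (simp add: M_def)
      then show "y \<in> Range (M A)" by blast
    qed (auto simp: M_def)
    have "(x, x') \<in> r \<longleftrightarrow> (y, y') \<in> r" if "(x, y) \<in> M A" "(x', y') \<in> M A" for x y x' y'
      using that rank_less_iff[OF lin fA AU(1), of x x']
        rank_less_iff[OF lin _ _, of "U - A" y y'] fin by (auto simp: M_def)
    moreover have "M A \<subseteq> U \<times> U" using AU by (auto simp: M_def)
    ultimately show ?thesis
      using D Rg AU unfolding monotone_matchings_def by blast
  qed
  show "bij_betw Domain (monotone_matchings U r m) (halves U m)"
    by (rule bij_betw_byWitness[of _ M]) (use unique exist in auto)
qed


section \<open>Definability\<close>

text \<open>
  The conjuncts say, in this order: the relation preserves and reflects the order, its domain and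
  range cover the universe, they are disjoint, and the least element is in the domain. As the
  order is total, the first conjunct already makes the relation functional and injective.
\<close>

definition matching_sentence :: mso where
  "matching_sentence =
     Conj (Neg (Ex 0 (Ex 1 (Ex 2 (Ex 3 (Conj (Conj (Rel 0 [0, 1]) (Rel 0 [2, 3]))
        (Neg (Conj (Neg (Conj (Less 0 2) (Neg (Less 1 3))))
                   (Neg (Conj (Less 1 3) (Neg (Less 0 2)))))))))))) (
     Conj (Neg (Ex 0 (Neg (Ex 1 (Neg (Conj (Neg (Rel 0 [0, 1])) (Neg (Rel 0 [1, 0])))))))) (
     Conj (Neg (Ex 0 (Ex 1 (Ex 2 (Conj (Rel 0 [0, 1]) (Rel 0 [1, 2]))))))
          (Ex 0 (Ex 1 (Conj (Rel 0 [0, 1]) (Neg (Ex 2 (Less 2 0))))))))"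

lemma mso_sentence_matching_sentence: "mso_sentence [2] matching_sentence"
  by (auto simp: mso_sentence_def matching_sentence_def)

text \<open>Structures interpret a binary symbol by lists of length 2, whereas matchings are sets of
  pairs.\<close>

definition pair_lists :: "('a \<times> 'a) set \<Rightarrow> 'a list set" where
  "pair_lists R = (\<lambda>(x, y). [x, y]) ` R"

lemma pair_lists_iff: "[x, y] \<in> pair_lists R \<longleftrightarrow> (x, y) \<in> R"
  by (auto simp: pair_lists_def)

lemma inj_pair_lists: "inj pair_lists"
  by (rule injI) (metis pair_lists_iff subrelI subset_antisym)

lemma relation_tuples_binary:
  "relation_tuples [2] U = (\<lambda>R. [pair_lists R]) ` Pow (U \<times> U)"
proof (intro equalityI subsetI)
  fix Rs assume "Rs \<in> relation_tuples [2] U"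
  then obtain S where Rs: "Rs = [S]" and S: "S \<subseteq> tuples U 2"
    by (auto simp: relation_tuples_def length_Suc_conv)
  let ?R = "{(x, y). [x, y] \<in> S}"
  have "S = pair_lists ?R"
    using S by (force simp: pair_lists_def tuples_def length_Suc_conv numeral_2_eq_2)
  moreover have "?R \<subseteq> U \<times> U" using S by (auto simp: tuples_def)
  ultimately show "Rs \<in> (\<lambda>R. [pair_lists R]) ` Pow (U \<times> U)" using Rs by blast
qed (force simp: relation_tuples_def pair_lists_def tuples_def)

text \<open>The bounds on the quantifiers are harmless because \<open>R\<close> lies within
  \<open>U \<times> U\<close>. The sentence cannot name \<open>m\<close>, but by totality
  \<open>m\<close> is the only minimal element.\<close>

lemma models_matching_sentence:
  assumes lin: "is_linear_order U r" and m: "m \<in> U" "\<And>x. x \<in> U \<Longrightarrow> (x, m) \<notin> r"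
    and R: "R \<subseteq> U \<times> U"
  shows "models \<lparr>universe = U, ord_rel = r, rels = [pair_lists R]\<rparr> matching_sentence
    \<longleftrightarrow> R \<in> monotone_matchings U r m"
proof -
  let ?mono = "\<forall>x\<in>U. \<forall>y\<in>U. \<forall>x'\<in>U. \<forall>y'\<in>U. (x, y) \<in> R \<and> (x', y') \<in> R \<longrightarrow>
      ((x, x') \<in> r \<longleftrightarrow> (y, y') \<in> r)"
  let ?cov = "\<forall>x\<in>U. \<exists>y\<in>U. (x, y) \<in> R \<or> (y, x) \<in> R"
  let ?disj = "\<forall>x\<in>U. \<forall>y\<in>U. \<forall>z\<in>U. (x, y) \<in> R \<longrightarrow> (y, z) \<notin> R"
  let ?min = "\<exists>x\<in>U. \<exists>y\<in>U. (x, y) \<in> R \<and> (\<forall>z\<in>U. (z, x) \<notin> r)"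
  have "models \<lparr>universe = U, ord_rel = r, rels = [pair_lists R]\<rparr> matching_sentence
      \<longleftrightarrow> sat \<lparr>universe = U, ord_rel = r, rels = [pair_lists R]\<rparr>
            (\<lambda>_. m) (\<lambda>_. {}) matching_sentence"
    by (rule models_iff_sat[OF mso_sentence_matching_sentence])
  also have "\<dots> \<longleftrightarrow> ?mono \<and> ?cov \<and> ?disj \<and> ?min"
    by (simp add: matching_sentence_def pair_lists_iff) blast
  also have "?mono \<longleftrightarrow> (\<forall>x y x' y'. (x, y) \<in> R \<longrightarrow> (x', y') \<in> R \<longrightarrow>
      ((x, x') \<in> r \<longleftrightarrow> (y, y') \<in> r))"
    using R by blast
  also have "?cov \<longleftrightarrow> Domain R \<union> Range R = U"
    using R by blast
  also have "?disj \<longleftrightarrow> Domain R \<inter> Range R = {}"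
    using R by blast
  also have "?min \<longleftrightarrow> m \<in> Domain R"
  proof
    assume ?min
    then obtain x y where xy: "x \<in> U" "(x, y) \<in> R" "\<And>z. z \<in> U \<Longrightarrow> (z, x) \<notin> r" by blast
    then have "x = m" using is_linear_orderD(3)[OF lin, of x m] m by blast
    then show "m \<in> Domain R" using xy by blast
  qed (use m R in blast)
  finally show ?thesis using R by (simp add: monotone_matchings_def)
qed

text \<open>An element of minimal rank has nothing below it.\<close>

lemma is_linear_order_least:
  assumes "is_linear_order U r" "finite U" "U \<noteq> {}"
  obtains m where "m \<in> U" "\<And>x. x \<in> U \<Longrightarrow> (x, m) \<notin> r"
proof -
  obtain m where m: "m \<in> U" "\<And>x. x \<in> U \<Longrightarrow> rank r U m \<le> rank r U x"
    using assms(2,3) by (metis ex_is_arg_min_if_finite is_arg_min_linorder)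
  then have "(x, m) \<notin> r" if "x \<in> U" for x
    using rank_strict_mono[OF assms(1,2) that] that by (metis leD)
  then show ?thesis using m(1) that by blast
qed

section \<open>Order invariant counting of the models\<close>

definition matching_class :: "nat ostruct set" where
  "matching_class = {\<AA>. ordered_structure [2] \<AA> \<and> models \<AA> matching_sentence}"

text \<open>The order enters the count only through its least element \<open>m\<close>, and the
  number of halves containing \<open>m\<close> is \<open>E2eq n\<close> for every \<open>m\<close>.
  This gives order invariance.\<close>

lemma osp_matching_class:
  assumes "n \<ge> 1" "is_linear_order {1..n} r"
  shows "osp [2] matching_class n r = E2eq n"
proof -
  let ?U = "{1..n}"
  obtain m where m: "m \<in> ?U" "\<And>x. x \<in> ?U \<Longrightarrow> (x, m) \<notin> r"
    using is_linear_order_least[OF assms(2)] assms(1) by auto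
  have "{Rs \<in> relation_tuples [2] ?U. \<lparr>universe = ?U, ord_rel = r, rels = Rs\<rparr> \<in> matching_class}
      = {Rs \<in> relation_tuples [2] ?U.
          models \<lparr>universe = ?U, ord_rel = r, rels = Rs\<rparr> matching_sentence}"
    using assms by (auto simp: matching_class_def ordered_structure_def)
  also have "\<dots> = (\<lambda>R. [pair_lists R]) ` monotone_matchings ?U r m"
  proof -
    have "monotone_matchings ?U r m \<subseteq> Pow (?U \<times> ?U)"
      by (auto simp: monotone_matchings_def)
    then show ?thesis
      unfolding relation_tuples_binary
      using models_matching_sentence[OF assms(2) m] by blast
  qed
  finally have "osp [2] matching_class n r
      = card ((\<lambda>R. [pair_lists R]) ` monotone_matchings ?U r m)"
    by (simp add: osp_def)
  also have "\<dots> = card (monotone_matchings ?U r m)"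
    using inj_pair_lists by (intro card_image) (auto simp: inj_on_def)
  also have "\<dots> = card (halves ?U m)"
    using assms(2) by (intro card_monotone_matchings) auto
  also have "\<dots> = E2eq n" using E2eq_eq_card_halves[OF m(1)] by simp
  finally show ?thesis .
qed

lemma order_invariant_specker_E2eq: "order_invariant_specker 2 E2eq"
  unfolding order_invariant_specker_def
proof (intro exI conjI)
  show "\<forall>a \<in> set [2]. a \<le> (2::nat)" by simp
  show "ordered_class [2] matching_class" by (simp add: ordered_class_def matching_class_def)
  show "mso_definable [2] matching_class"
    using mso_sentence_matching_sentence by (auto simp: mso_definable_def matching_class_def)
  show "\<forall>n\<ge>1. \<forall>r1 r2. is_linear_order {1..n} r1 \<and> is_linear_order {1..n} r2 \<longrightarrow>
      E2eq n = osp [2] matching_class n r1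
      \<and> osp [2] matching_class n r1 = osp [2] matching_class n r2"
    by (simp add: osp_matching_class)
qed

theorem proposition12:
  shows "(\<forall>n\<ge>1. real (E2eq (2 * n)) = 1 / 2 * real ((2 * n) choose n))
    \<and> (\<forall>n. E2eq (2 * n + 1) = 0)
    \<and> order_invariant_specker 2 E2eq
    \<and> \<not> ultimately_periodic_mod 2 E2eq
    \<and> \<not> satisfies_linear_recurrence_mod 2 E2eq"
proof (intro conjI allI impI)
  fix n :: nat assume "n \<ge> 1"
  then obtain k where n: "n = Suc k" by (cases n) auto
  show "real (E2eq (2 * n)) = 1 / 2 * real ((2 * n) choose n)"
    unfolding n E2eq_even central_binomial_Suc by simp
next
  show "E2eq (2 * n + 1) = 0" for n by (rule E2eq_odd)
  show "order_invariant_specker 2 E2eq" by (rule order_invariant_specker_E2eq)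
  show "\<not> ultimately_periodic_mod 2 E2eq" by (rule not_ultimately_periodic_E2eq)
  then show "\<not> satisfies_linear_recurrence_mod 2 E2eq"
    using linear_recurrence_imp_ultimately_periodic[of 2 E2eq] by auto
qed

end
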